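(* Let $M$ and $N$ be loopless matroids of finite rank on a common ground set $E$, with rank functions $r_M,r_N$. Then $I\subseteq E$ is independent in $\mathcal{M}(r_M+r_N-1)$ if and only if $\dim(\pi_I(\mathrm{berg}(M)+\mathrm{berg}(N)))=|I|$.
   Context: A flag of flats of a matroid $M$ on $E$ is a set of nested nonempty flats of $M$. For a flag $\mathcal{F}$ and $e\in E$, $\mathcal{F}^e$ is the minimal element of $\mathcal{F}$ containing $e$. For a flag $\mathcal{F}$, $K_{\mathcal{F}}=\{\omega\in\mathbb{R}^E:\omega_e\le\omega_f \text{ when } \mathcal{F}^e\subsetneq\mathcal{F}^f, \ \omega_e=\omega_f \text{ when } \mathcal{F}^e=\mathcal{F}^f\}$, and the Bergman fan $\mathrm{berg}(M)$ of a loopless matroid is the union of $K_{\mathcal{F}}$ over all flags of flats. $+$ is Minkowski sum, $\pi_I:\mathbb{R}^E\to\mathbb{R}^I$ the coordinate projection, and the dimension of a union of polyhedral cones is the maximal dimension of one of the cones. For $f:2^E\to\mathbb{Z}$ submodular, monotone and bounded above, $\mathcal{M}(f)$ is the matroid on $E$ whose independent sets are $\emptyset$ and the sets $I$ with $|I'|\le f(I')$ for every nonempty $I'\subseteq I$. *)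

theory Defs
  imports "HOL-Analysis.Analysis" "HOL-Library.Function_Algebras" "HOL-Library.Set_Algebras"
begin

section \<open>Functions as a real vector space\<close>

instantiation "fun" :: (type, real_vector) real_vector
begin

definition scaleR_fun :: "real \<Rightarrow> ('a \<Rightarrow> 'b) \<Rightarrow> 'a \<Rightarrow> 'b" where
  "scaleR_fun c f = (\<lambda>x. c *\<^sub>R f x)"

instance
  by standard (auto simp: scaleR_fun_def plus_fun_def scaleR_add_right scaleR_add_left)

end


section \<open>Matroids of finite rank\<close>

text \<open>The ground set may be infinite; finite rank means that the independent sets are finite and
  of bounded size.\<close>

locale finite_rank_matroid =
  fixes E :: "'a set" and indep :: "'a set \<Rightarrow> bool"
  assumes indep_subset_ground: "indep I \<Longrightarrow> I \<subseteq> E"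
    and indep_empty: "indep {}"
    and indep_subset: "indep J \<Longrightarrow> I \<subseteq> J \<Longrightarrow> indep I"
    and indep_augment:
      "indep I \<Longrightarrow> indep J \<Longrightarrow> card I < card J \<Longrightarrow> \<exists>x\<in>J - I. indep (insert x I)"
    and indep_bounded: "\<exists>n. \<forall>I. indep I \<longrightarrow> finite I \<and> card I \<le> n"

definition loopless :: "'a set \<Rightarrow> ('a set \<Rightarrow> bool) \<Rightarrow> bool" where
  "loopless E indep \<longleftrightarrow> (\<forall>e\<in>E. indep {e})"

definition matroid_rank :: "('a set \<Rightarrow> bool) \<Rightarrow> 'a set \<Rightarrow> nat" where
  "matroid_rank indep A = Max (card ` {J. J \<subseteq> A \<and> indep J})"

definition flat :: "'a set \<Rightarrow> ('a set \<Rightarrow> bool) \<Rightarrow> 'a set \<Rightarrow> bool" where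
  "flat E indep F \<longleftrightarrow>
     F \<subseteq> E \<and> (\<forall>e\<in>E - F. matroid_rank indep F < matroid_rank indep (insert e F))"

definition flag_of_flats :: "'a set \<Rightarrow> ('a set \<Rightarrow> bool) \<Rightarrow> 'a set set \<Rightarrow> bool" where
  "flag_of_flats E indep \<F> \<longleftrightarrow> (\<forall>F\<in>\<F>. flat E indep F \<and> F \<noteq> {}) \<and> chain\<^sub>\<subseteq> \<F>"


section \<open>Bergman fans\<close>

text \<open>A flag need not contain the flat \<open>E\<close>, so possibly no member of \<open>\<F>\<close> contains \<open>e\<close>; then
  \<open>\<F>\<^sup>e\<close> is \<open>E\<close>. Equivalently, flags are regarded as ending in \<open>E\<close>.\<close>

definition flag_min :: "'a set \<Rightarrow> 'a set set \<Rightarrow> 'a \<Rightarrow> 'a set" where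
  "flag_min E \<F> e = (LEAST F. F \<in> insert E \<F> \<and> e \<in> F)"

text \<open>A vector of \<open>\<real>\<^sup>A\<close> is a function vanishing outside \<open>A\<close>.\<close>

definition coord_space :: "'a set \<Rightarrow> ('a \<Rightarrow> real) set" where
  "coord_space A = {\<omega>. \<forall>e. e \<notin> A \<longrightarrow> \<omega> e = 0}"

definition coord_proj :: "'a set \<Rightarrow> ('a \<Rightarrow> real) \<Rightarrow> 'a \<Rightarrow> real" where
  "coord_proj I \<omega> = (\<lambda>e. if e \<in> I then \<omega> e else 0)"

definition flag_cone :: "'a set \<Rightarrow> 'a set set \<Rightarrow> ('a \<Rightarrow> real) set" where
  "flag_cone E \<F> = {\<omega> \<in> coord_space E. \<forall>e\<in>E. \<forall>f\<in>E.
     (flag_min E \<F> e \<subset> flag_min E \<F> f \<longrightarrow> \<omega> e \<le> \<omega> f) \<and>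
     (flag_min E \<F> e = flag_min E \<F> f \<longrightarrow> \<omega> e = \<omega> f)}"

definition bergman_fan :: "'a set \<Rightarrow> ('a set \<Rightarrow> bool) \<Rightarrow> ('a \<Rightarrow> real) set" where
  "bergman_fan E indep = (\<Union>\<F>\<in>{\<F>. flag_of_flats E indep \<F>}. flag_cone E \<F>)"


section \<open>Dimension of a union of polyhedral cones\<close>

text \<open>Polyhedral cones are taken to be the finitely generated ones, which makes sense in
  \<open>\<real>\<^sup>E\<close> also for infinite \<open>E\<close>.\<close>

definition polyhedral_cone :: "'v::real_vector set \<Rightarrow> bool" where
  "polyhedral_cone C \<longleftrightarrow> (\<exists>S. finite S \<and> C = convex_cone hull S)"

text \<open>The dimension of a cone is that of its linear span, which is what \<^const>\<open>dim\<close> gives. The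
  cones must be finite in number: the plane is also an infinite union of rays. Independence of the
  chosen cones is shown in \<open>cones_dim_Union\<close> below.\<close>

definition cones_dim :: "'v::real_vector set \<Rightarrow> nat" where
  "cones_dim X = (THE d. \<exists>\<C>. finite \<C> \<and> \<C> \<noteq> {} \<and> (\<forall>C\<in>\<C>. polyhedral_cone C) \<and>
     X = \<Union>\<C> \<and> d = Max (dim ` \<C>))"

lemma convex_cone_subset_Union_subspaces:
  fixes C :: "'v::real_vector set"
  assumes "finite \<S>" "\<forall>S\<in>\<S>. subspace S" "convex_cone C" "C \<subseteq> \<Union>\<S>"
  shows "\<exists>S\<in>\<S>. C \<subseteq> S"
  using assms
proof (induction \<S> rule: finite_induct)
  case empty
  then show ?case by (auto simp: convex_cone_def)
next
  case (insert S \<S>)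
  show ?case
  proof (rule ccontr)
    assume neg: "\<not> ?case"
    then have "\<not> C \<subseteq> \<Union>\<S>" using insert by auto
    then obtain y where y: "y \<in> C" "y \<notin> \<Union>\<S>" by blast
    then have yS: "y \<in> S" using insert.prems by auto
    obtain x where x: "x \<in> C" "x \<notin> S" using neg by auto
    have inU: "x + real (Suc n) *\<^sub>R y \<in> \<Union>\<S>" for n
    proof -
      have "x + real (Suc n) *\<^sub>R y \<in> C"
        using insert.prems(2) x(1) y(1) by (intro convex_cone_add convex_cone_scaleR) auto
      moreover have "x + real (Suc n) *\<^sub>R y \<notin> S"
        using insert.prems(1) x(2) yS
        by (metis insertI1 subspace_scale subspace_diff add_diff_cancel_right')
      ultimately show ?thesis using insert.prems by auto
    qed
    then have "\<forall>n. \<exists>T\<in>\<S>. x + real (Suc n) *\<^sub>R y \<in> T" by blast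
    then obtain T where T: "\<And>n. T n \<in> \<S>" "\<And>n. x + real (Suc n) *\<^sub>R y \<in> T n" by metis
    have "\<not> inj T"
      using finite_subset[OF _ insert.hyps(1), of "range T"] T(1) finite_imageD infinite_UNIV_nat
      by blast
    then obtain m n where mn: "m \<noteq> n" "T m = T n" by (auto simp: inj_def)
    have sub: "subspace (T n)" using T(1) insert.prems by auto
    have "(x + real (Suc m) *\<^sub>R y) - (x + real (Suc n) *\<^sub>R y) \<in> T n"
      using subspace_diff[OF sub T(2)[of m, unfolded mn(2)] T(2)[of n]] .
    moreover have "(x + real (Suc m) *\<^sub>R y) - (x + real (Suc n) *\<^sub>R y) = (real m - real n) *\<^sub>R y"
      by (simp add: algebra_simps)
    ultimately have "(real m - real n) *\<^sub>R y \<in> T n" by simp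
    from subspace_scale[OF sub this, of "inverse (real m - real n)"]
    have "y \<in> T n" using mn by simp
    then show False using y T(1) by blast
  qed
qed

lemma dim_polyhedral_cone_mono:
  assumes "polyhedral_cone D" "C \<subseteq> span D"
  shows "dim C \<le> dim D"
proof -
  obtain S where S: "finite S" "D = convex_cone hull S"
    using assms(1) by (auto simp: polyhedral_cone_def)
  have "D \<subseteq> span S"
    unfolding S(2) by (rule hull_minimal) (auto simp: span_superset subspace_imp_convex_cone)
  obtain B where B: "B \<subseteq> D" "independent B" "D \<subseteq> span B" "card B = dim D"
    using basis_exists by metis
  obtain A where A: "A \<subseteq> C" "independent A" "card A = dim C"
    using basis_exists by metis
  have "finite B"
    using independent_span_bound[OF S(1) B(2)] B(1) \<open>D \<subseteq> span S\<close> by blast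
  moreover have "A \<subseteq> span B"
    using A(1) assms(2) B(3) span_minimal[OF B(3) subspace_span] by blast
  ultimately show ?thesis using independent_span_bound A B by metis
qed

lemma Max_dim_polyhedral_cones_mono:
  assumes "finite \<C>" "\<C> \<noteq> {}" "\<forall>C\<in>\<C>. polyhedral_cone C"
    and "finite \<D>" "\<forall>D\<in>\<D>. polyhedral_cone D" "\<Union>\<C> \<subseteq> \<Union>\<D>"
  shows "Max (dim ` \<C>) \<le> Max (dim ` \<D>)"
proof -
  have "dim C \<le> Max (dim ` \<D>)" if C: "C \<in> \<C>" for C
  proof -
    have "C \<subseteq> \<Union>(span ` \<D>)"
    proof
      fix x assume "x \<in> C"
      then obtain D where "D \<in> \<D>" "x \<in> D" using C assms(6) by blast
      then show "x \<in> \<Union>(span ` \<D>)" by (auto intro: span_base)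
    qed
    moreover have "convex_cone C"
      using C assms(3) convex_cone_convex_cone_hull unfolding polyhedral_cone_def by metis
    ultimately have "\<exists>S\<in>span ` \<D>. C \<subseteq> S"
      by (intro convex_cone_subset_Union_subspaces) (auto simp: assms(4))
    then obtain D where "D \<in> \<D>" "C \<subseteq> span D" by blast
    then have "dim C \<le> dim D" using dim_polyhedral_cone_mono assms(5) by blast
    also have "\<dots> \<le> Max (dim ` \<D>)" using \<open>D \<in> \<D>\<close> assms(4) by (intro Max_ge) auto
    finally show ?thesis .
  qed
  then show ?thesis using assms(1,2) by simp
qed

lemma cones_dim_Union:
  assumes "finite \<C>" "\<C> \<noteq> {}" "\<forall>C\<in>\<C>. polyhedral_cone C"
  shows "cones_dim (\<Union>\<C>) = Max (dim ` \<C>)"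
  unfolding cones_dim_def
proof (rule the_equality)
  show "\<exists>\<D>. finite \<D> \<and> \<D> \<noteq> {} \<and> (\<forall>C\<in>\<D>. polyhedral_cone C) \<and> \<Union>\<C> = \<Union>\<D> \<and>
      Max (dim ` \<C>) = Max (dim ` \<D>)"
    using assms by blast
next
  fix d
  assume "\<exists>\<D>. finite \<D> \<and> \<D> \<noteq> {} \<and> (\<forall>C\<in>\<D>. polyhedral_cone C) \<and> \<Union>\<C> = \<Union>\<D> \<and> d = Max (dim ` \<D>)"
  then obtain \<D> where \<D>: "finite \<D>" "\<D> \<noteq> {}" "\<forall>C\<in>\<D>. polyhedral_cone C"
      "\<Union>\<C> = \<Union>\<D>" "d = Max (dim ` \<D>)"
    by (elim exE conjE)
  show "d = Max (dim ` \<C>)"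
    unfolding \<D>(5)
  proof (rule order_antisym)
    show "Max (dim ` \<D>) \<le> Max (dim ` \<C>)"
      by (rule Max_dim_polyhedral_cones_mono) (simp_all add: \<D>(1-3) assms flip: \<D>(4))
    show "Max (dim ` \<C>) \<le> Max (dim ` \<D>)"
      by (rule Max_dim_polyhedral_cones_mono) (simp_all add: \<D>(1-3) assms \<D>(4))
  qed
qed


section \<open>The matroid of a submodular function\<close>

text \<open>Since \<open>f\<close> has integer values, \<open>|I'| \<le> f I'\<close> includes finiteness of \<open>I'\<close>, which has to be
  stated because \<^const>\<open>card\<close> is \<open>0\<close> on infinite sets.\<close>

definition submodular_indep :: "'a set \<Rightarrow> ('a set \<Rightarrow> int) \<Rightarrow> 'a set \<Rightarrow> bool" where
  "submodular_indep E f I \<longleftrightarrow>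
     I \<subseteq> E \<and> (I = {} \<or> (\<forall>I'\<subseteq>I. I' \<noteq> {} \<longrightarrow> finite I' \<and> int (card I') \<le> f I'))"

end

theory Submission
  imports Defs
begin

text \<open>On a finite \<open>I\<close>, the projection of a cone \<open>K\<^sub>\<F>\<close> is generated by \<open>\<plusminus>1\<^sub>I\<close> and the
  indicators \<open>1\<^bsub>I - F\<^esub>\<close> of members of the flag. So the projected sum of two Bergman fans is a finite
  union of polyhedral cones, and it has dimension \<open>|I|\<close> iff for some pair of flags these generators
  span \<open>\<real>\<^sup>I\<close>. If they do, then for nonempty \<open>A \<subseteq> I\<close> their restrictions span \<open>\<real>\<^sup>A\<close>; the
  traces of a flag on \<open>A\<close> that are nonempty and proper have distinct ranks strictly between \<open>0\<close> and
  \<open>r A\<close>, and both flags share \<open>1\<^sub>A\<close>, whence \<open>|A| \<le> 1 + (r\<^sub>M A - 1) + (r\<^sub>N A - 1)\<close>.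

  Conversely, the matroid union theorem writes \<open>I = B \<union> C\<close> with \<open>B\<close> independent in \<open>M\<close> and
  \<open>C\<close> in \<open>N\<close>. Every nonempty \<open>X \<subseteq> I\<close> has an element \<open>x\<close> for which \<open>(B \<inter> X) \<union> {x}\<close> and
  \<open>(C \<inter> X) \<union> {x}\<close> are independent: otherwise \<open>X\<close> is the disjoint union of \<open>B \<inter> X\<close> and
  \<open>C \<inter> X\<close>, each spanning \<open>X\<close>, and \<open>|X| = r\<^sub>M X + r\<^sub>N X\<close>. Removing such elements one by one orders
  \<open>I\<close>, and the spans of the final segments of \<open>B\<close> and \<open>C\<close> are flags whose indicators form a
  triangular system.\<close>

section \<open>Rank, flats and flags\<close>

context finite_rank_matroid
begin

lemma finite_indep: "indep J \<Longrightarrow> finite J"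
  using indep_bounded by blast

lemma finite_card_indep: "finite (card ` {J. J \<subseteq> A \<and> indep J})"
proof -
  obtain n where "\<forall>J. indep J \<longrightarrow> card J \<le> n" using indep_bounded by blast
  then have "card ` {J. J \<subseteq> A \<and> indep J} \<subseteq> {..n}" by auto
  then show ?thesis by (rule finite_subset) simp
qed

lemma card_le_rank: "J \<subseteq> A \<Longrightarrow> indep J \<Longrightarrow> card J \<le> matroid_rank indep A"
  unfolding matroid_rank_def by (intro Max_ge finite_card_indep) auto

lemma rank_attained: obtains J where "J \<subseteq> A" "indep J" "card J = matroid_rank indep A"
proof -
  have "matroid_rank indep A \<in> card ` {J. J \<subseteq> A \<and> indep J}"
    unfolding matroid_rank_def using indep_empty by (intro Max_in finite_card_indep) auto
  then show ?thesis using that by auto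
qed

lemma rank_mono: "A \<subseteq> B \<Longrightarrow> matroid_rank indep A \<le> matroid_rank indep B"
  by (rule rank_attained[of A]) (metis card_le_rank subset_trans)

lemma rank_le_card: "finite A \<Longrightarrow> matroid_rank indep A \<le> card A"
  by (rule rank_attained[of A]) (metis card_mono)

lemma indep_if_card_le_rank:
  assumes "finite A" "card A \<le> matroid_rank indep A"
  shows "indep A"
proof -
  obtain J where "J \<subseteq> A" "indep J" "card J = matroid_rank indep A"
    by (rule rank_attained)
  then show ?thesis using card_subset_eq[of A J] card_mono[of A J] assms by auto
qed

lemma extend_indep:
  assumes "indep J" "J \<subseteq> A"
  obtains K where "J \<subseteq> K" "K \<subseteq> A" "indep K" "card K = matroid_rank indep A"
proof -
  have "\<exists>K. J \<subseteq> K \<and> K \<subseteq> A \<and> indep K \<and> card K = matroid_rank indep A"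
    using assms
  proof (induction "matroid_rank indep A - card J" arbitrary: J)
    case 0
    then have "card J = matroid_rank indep A" using card_le_rank[of J A] by simp
    then show ?case using 0 by blast
  next
    case (Suc d)
    obtain L where L: "L \<subseteq> A" "indep L" "card L = matroid_rank indep A"
      by (rule rank_attained)
    have "card J < card L" using Suc.hyps(2) L(3) by simp
    from indep_augment[OF Suc.prems(1) L(2) this]
    obtain x where x: "x \<in> L - J" "indep (insert x J)" by blast
    have "card (insert x J) = Suc (card J)"
      using x finite_indep[OF Suc.prems(1)] by simp
    then have "d = matroid_rank indep A - card (insert x J)" using Suc.hyps(2) by simp
    from Suc.hyps(1)[OF this x(2)] show ?case using x(1) L(1) Suc.prems(2) by auto
  qed
  then show ?thesis using that by blast
qed

text \<open>Inclusion-exclusion for \<open>K \<inter> A\<close> and \<open>K \<inter> B\<close>,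
  where \<open>K\<close> is a maximal independent subset of the union grown from one of the
  intersection.\<close>

lemma rank_submodular:
  "matroid_rank indep (A \<union> B) + matroid_rank indep (A \<inter> B)
     \<le> matroid_rank indep A + matroid_rank indep B"
proof -
  obtain J where J: "J \<subseteq> A \<inter> B" "indep J" "card J = matroid_rank indep (A \<inter> B)"
    by (rule rank_attained)
  obtain K where K: "J \<subseteq> K" "K \<subseteq> A \<union> B" "indep K" "card K = matroid_rank indep (A \<union> B)"
    using extend_indep[OF J(2), of "A \<union> B"] J(1) by blast
  have fin: "finite K" using K(3) by (rule finite_indep)
  have "card K + card J \<le> card ((K \<inter> A) \<union> (K \<inter> B)) + card ((K \<inter> A) \<inter> (K \<inter> B))"
    using J(1) K(1,2) fin by (intro add_mono card_mono) auto
  also have "\<dots> = card (K \<inter> A) + card (K \<inter> B)"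
    using fin by (intro card_Un_Int[symmetric]) auto
  also have "\<dots> \<le> matroid_rank indep A + matroid_rank indep B"
    using K(3) by (intro add_mono card_le_rank) (auto intro: indep_subset)
  finally show ?thesis using J(3) K(4) by simp
qed

text \<open>By submodularity the rank gained from \<open>e\<close> can only shrink as the set grows
  from \<open>A\<close> to \<open>F\<close>, and over the flat \<open>F\<close> it is still
  positive.\<close>

lemma flat_not_spanned:
  assumes "flat E indep F" "A \<subseteq> F" "e \<in> E - F"
  shows "matroid_rank indep A < matroid_rank indep (insert e A)"
proof -
  have "insert e A \<union> F = insert e F" "A \<subseteq> insert e A \<inter> F" using assms by auto
  then have "matroid_rank indep (insert e F) + matroid_rank indep A
      \<le> matroid_rank indep (insert e A) + matroid_rank indep F"
    using rank_submodular[of "insert e A" F] rank_mono[of A "insert e A \<inter> F"] by simp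
  moreover have "matroid_rank indep F < matroid_rank indep (insert e F)"
    using assms by (auto simp: flat_def)
  ultimately show ?thesis by linarith
qed

text \<open>The usual matroid closure when \<open>B\<close> is independent, put in terms of
  \<open>indep\<close> instead of rank. For dependent \<open>B\<close> it is all of
  \<open>E\<close>, so monotonicity extends to arbitrary sets.\<close>

definition span_of :: "'a set \<Rightarrow> 'a set" where
  "span_of B = {e \<in> E. e \<in> B \<or> \<not> indep (insert e B)}"

lemma span_of_mono: "A \<subseteq> B \<Longrightarrow> span_of A \<subseteq> span_of B"
  unfolding span_of_def using indep_subset[OF _ insert_mono] by blast

text \<open>An independent subset of the span larger than \<open>B\<close> would augment
  \<open>B\<close> by a spanned element, which is impossible. So the span has rank at most
  \<open>card B\<close>, while \<open>insert e B\<close> is independent for every \<open>e\<close>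
  in \<open>E\<close> outside it.\<close>

lemma flat_span_of:
  assumes "indep B"
  shows "flat E indep (span_of B)"
proof -
  have "matroid_rank indep (span_of B) < matroid_rank indep (insert e (span_of B))"
    if e: "e \<in> E - span_of B" for e
  proof -
    have BE: "B \<subseteq> span_of B" using assms indep_subset_ground by (auto simp: span_of_def)
    obtain J where J: "J \<subseteq> span_of B" "indep J" "card J = matroid_rank indep (span_of B)"
      by (rule rank_attained)
    have "card J \<le> card B"
    proof (rule ccontr)
      assume "\<not> card J \<le> card B"
      then obtain x where "x \<in> J - B" "indep (insert x B)"
        using indep_augment[OF assms J(2)] by auto
      then show False using J(1) by (auto simp: span_of_def)
    qed
    also have "card B < card (insert e B)"
      using e BE finite_indep[OF assms] by (subst card_insert_disjoint) auto
    also have "\<dots> \<le> matroid_rank indep (insert e (span_of B))"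
      using e BE by (intro card_le_rank) (auto simp: span_of_def)
    finally show ?thesis using J(3) by simp
  qed
  then show ?thesis by (auto simp: flat_def span_of_def)
qed

text \<open>\<open>LEAST\<close> is meaningful only once a least member is known to exist. One of
  smallest rank among those containing \<open>e\<close> is least, because in a chain of flats a
  proper inclusion raises the rank; \<open>E\<close> guarantees a candidate.\<close>

lemma flag_min_props:
  assumes flag: "flag_of_flats E indep \<F>" and e: "e \<in> E"
  shows "flag_min E \<F> e \<in> insert E \<F>" "e \<in> flag_min E \<F> e"
    and "\<And>F. F \<in> insert E \<F> \<Longrightarrow> e \<in> F \<Longrightarrow> flag_min E \<F> e \<subseteq> F"
proof -
  have flats: "flat E indep F" if "F \<in> insert E \<F>" for F
    using that flag by (auto simp: flag_of_flats_def flat_def)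
  obtain F where F: "F \<in> insert E \<F>" "e \<in> F"
    and min: "\<And>G. G \<in> insert E \<F> \<Longrightarrow> e \<in> G \<Longrightarrow> matroid_rank indep F \<le> matroid_rank indep G"
    using ex_has_least_nat[of "\<lambda>F. F \<in> insert E \<F> \<and> e \<in> F" E "matroid_rank indep"] e by auto
  have least: "F \<subseteq> G" if G: "G \<in> insert E \<F>" "e \<in> G" for G
  proof (rule ccontr)
    assume "\<not> F \<subseteq> G"
    then obtain x where x: "x \<in> F" "x \<notin> G" by blast
    have sub: "F \<subseteq> E" using flats[OF F(1)] by (simp add: flat_def)
    have "F \<subseteq> G \<or> G \<subseteq> F"
      using F(1) G(1) flag flats[OF F(1)] flats[OF G(1)]
      by (auto simp: flag_of_flats_def chain_subset_def flat_def)
    then have "insert x G \<subseteq> F" using x by auto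
    then have "matroid_rank indep (insert x G) \<le> matroid_rank indep F" by (rule rank_mono)
    moreover have "matroid_rank indep G < matroid_rank indep (insert x G)"
      using flats[OF G(1)] x sub by (auto simp: flat_def)
    ultimately show False using min[OF G] by simp
  qed
  have "flag_min E \<F> e = F"
    unfolding flag_min_def using F least by (intro Least_equality) auto
  then show "flag_min E \<F> e \<in> insert E \<F>" "e \<in> flag_min E \<F> e"
    "\<And>F. F \<in> insert E \<F> \<Longrightarrow> e \<in> F \<Longrightarrow> flag_min E \<F> e \<subseteq> F"
    using F least by auto
qed

end

section \<open>Matroid union and elimination orders\<close>

text \<open>Elements of \<open>S\<close> are assigned one at a time to the sets \<open>I\<close> and \<open>J\<close>, so no contractions are
  needed. If neither side accepts \<open>e\<close>, the sum of the two violated inequalities contradicts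
  submodularity.\<close>

lemma matroid_union_cover:
  assumes M: "finite_rank_matroid E M" and N: "finite_rank_matroid E N" and fin: "finite S"
    and IJ: "finite I" "finite J"
    and le: "\<And>A. A \<subseteq> S \<Longrightarrow>
      card A + card I + card J \<le> matroid_rank M (A \<union> I) + matroid_rank N (A \<union> J)"
  shows "\<exists>I' J'. M I' \<and> N J' \<and> I' \<union> J' = S \<union> I \<union> J"
  using fin IJ le
proof (induction S arbitrary: I J rule: finite_induct)
  case empty
  interpret M: finite_rank_matroid E M by (rule M)
  interpret N: finite_rank_matroid E N by (rule N)
  \<comment> \<open>With nothing left to assign, the hypothesis at the empty set meets the bounds of
    each rank by the cardinality, so both sets have full rank.\<close>
  have "card I + card J \<le> matroid_rank M I + matroid_rank N J" using empty(3)[of "{}"] by simp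
  then have "M I" "N J"
    using M.rank_le_card[OF empty(1)] N.rank_le_card[OF empty(2)] empty(1,2)
    by (auto intro!: M.indep_if_card_le_rank N.indep_if_card_le_rank)
  then show ?case by blast
next
  case (insert e S)
  interpret M: finite_rank_matroid E M by (rule M)
  interpret N: finite_rank_matroid E N by (rule N)
  let ?r = "matroid_rank M" and ?s = "matroid_rank N"
  have "(\<forall>A\<subseteq>S. card A + Suc (card I) + card J \<le> ?r (A \<union> insert e I) + ?s (A \<union> J)) \<or>
        (\<forall>A\<subseteq>S. card A + card I + Suc (card J) \<le> ?r (A \<union> I) + ?s (A \<union> insert e J))"
  proof (rule ccontr)
    assume "\<not> ?thesis"
    then obtain A B where AB: "A \<subseteq> S" "B \<subseteq> S"
      and A: "?r (A \<union> insert e I) + ?s (A \<union> J) \<le> card A + card I + card J"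
      and B: "?r (B \<union> I) + ?s (B \<union> insert e J) \<le> card B + card I + card J"
      by (auto simp: not_le)
    have fAB: "finite A" "finite B" using AB insert.hyps(1) finite_subset by auto
    have "?r (insert e (A \<union> B) \<union> I) + ?r (A \<inter> B \<union> I) \<le> ?r (A \<union> insert e I) + ?r (B \<union> I)"
      by (rule order_trans[OF add_mono[OF M.rank_mono M.rank_mono] M.rank_submodular]) auto
    moreover have "?s (insert e (A \<union> B) \<union> J) + ?s (A \<inter> B \<union> J) \<le> ?s (A \<union> J) + ?s (B \<union> insert e J)"
      by (rule order_trans[OF add_mono[OF N.rank_mono N.rank_mono] N.rank_submodular]) auto
    moreover have "card (insert e (A \<union> B)) + card I + card J
        \<le> ?r (insert e (A \<union> B) \<union> I) + ?s (insert e (A \<union> B) \<union> J)"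
      using AB by (intro insert.prems) auto
    moreover have "card (A \<inter> B) + card I + card J \<le> ?r (A \<inter> B \<union> I) + ?s (A \<inter> B \<union> J)"
      using AB by (intro insert.prems) auto
    moreover have "card (insert e (A \<union> B)) = Suc (card (A \<union> B))"
      using AB fAB insert.hyps by (subst card_insert_disjoint) auto
    moreover have "card A + card B = card (A \<union> B) + card (A \<inter> B)" using fAB by (rule card_Un_Int)
    ultimately show False using A B by linarith
  qed
  then show ?case
  proof
    assume *: "\<forall>A\<subseteq>S. card A + Suc (card I) + card J \<le> ?r (A \<union> insert e I) + ?s (A \<union> J)"
    have "\<exists>I' J'. M I' \<and> N J' \<and> I' \<union> J' = S \<union> insert e I \<union> J"
    proof (rule insert.IH)
      fix A assume "A \<subseteq> S"
      then have "card A + Suc (card I) + card J \<le> ?r (A \<union> insert e I) + ?s (A \<union> J)" using * by blast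
      \<comment> \<open>\<open>e\<close> may already lie in \<open>I\<close>; the bound with
        \<open>Suc\<close> then gives more than the induction hypothesis asks for.\<close>
      moreover have "card (insert e I) \<le> Suc (card I)" by (rule card_insert_le_m1) auto
      ultimately show "card A + card (insert e I) + card J \<le> ?r (A \<union> insert e I) + ?s (A \<union> J)"
        by linarith
    qed (use insert.prems in auto)
    then show ?thesis by auto
  next
    assume *: "\<forall>A\<subseteq>S. card A + card I + Suc (card J) \<le> ?r (A \<union> I) + ?s (A \<union> insert e J)"
    have "\<exists>I' J'. M I' \<and> N J' \<and> I' \<union> J' = S \<union> I \<union> insert e J"
    proof (rule insert.IH)
      fix A assume "A \<subseteq> S"
      then have "card A + card I + Suc (card J) \<le> ?r (A \<union> I) + ?s (A \<union> insert e J)" using * by blast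
      moreover have "card (insert e J) \<le> Suc (card J)" by (rule card_insert_le_m1) auto
      ultimately show "card A + card I + card (insert e J) \<le> ?r (A \<union> I) + ?s (A \<union> insert e J)"
        by linarith
    qed (use insert.prems in auto)
    then show ?thesis by auto
  qed
qed

text \<open>Remove a selected element, order the rest recursively and put the removed one at
  position 0. Then \<open>h\<close> is the order of removal, and
  \<open>{y \<in> S. h x \<le> h y}\<close> is what was left when \<open>x\<close> was
  selected.\<close>

lemma enumerate_by_selection:
  assumes "finite S" "\<And>X. X \<subseteq> S \<Longrightarrow> X \<noteq> {} \<Longrightarrow> \<exists>x\<in>X. Q x X"
  shows "\<exists>h::'a \<Rightarrow> nat. inj_on h S \<and> (\<forall>x\<in>S. Q x {y \<in> S. h x \<le> h y})"
  using assms
proof (induction S rule: finite_psubset_induct)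
  case (psubset S)
  show ?case
  proof (cases "S = {}")
    case False
    then obtain x where x: "x \<in> S" "Q x S" using psubset.prems by blast
    then have "S - {x} \<subset> S" by blast
    moreover have "\<exists>z\<in>X. Q z X" if "X \<subseteq> S - {x}" "X \<noteq> {}" for X
      using psubset.prems that by blast
    ultimately have "\<exists>h::'a \<Rightarrow> nat. inj_on h (S - {x}) \<and> (\<forall>z\<in>S - {x}. Q z {y \<in> S - {x}. h z \<le> h y})"
      by (rule psubset.IH)
    then obtain h :: "'a \<Rightarrow> nat" where
      h: "inj_on h (S - {x})" "\<And>z. z \<in> S - {x} \<Longrightarrow> Q z {y \<in> S - {x}. h z \<le> h y}" by blast
    define g where "g = (\<lambda>y. if y = x then 0 else Suc (h y))"
    have "inj_on g S" using h(1) by (auto simp: inj_on_def g_def)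
    moreover have "Q z {y \<in> S. g z \<le> g y}" if "z \<in> S" for z
    proof (cases "z = x")
      case True
      then have "{y \<in> S. g z \<le> g y} = S" by (auto simp: g_def)
      then show ?thesis using x True by simp
    next
      case False
      then have "{y \<in> S. g z \<le> g y} = {y \<in> S - {x}. h z \<le> h y}" by (auto simp: g_def)
      then show ?thesis using h(2)[of z] that False by simp
    qed
    ultimately show ?thesis by blast
  qed simp
qed

section \<open>Coordinate spaces and cones of flags\<close>

lemma linear_coord_proj: "linear (coord_proj I)"
  by (intro linearI) (auto simp: coord_proj_def plus_fun_def scaleR_fun_def fun_eq_iff)

lemma coord_proj_indicator: "coord_proj I (indicat_real S) = indicat_real (I \<inter> S)"
  by (auto simp: coord_proj_def indicator_def fun_eq_iff)

lemma subspace_coord_space: "subspace (coord_space I)"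
  by (auto simp: subspace_def coord_space_def plus_fun_def scaleR_fun_def zero_fun_def)

lemma coord_space_subset_span_units:
  assumes "finite I"
  shows "coord_space I \<subseteq> span ((\<lambda>x. indicat_real {x}) ` I)"
proof
  fix \<omega> assume "\<omega> \<in> coord_space I"
  with assms show "\<omega> \<in> span ((\<lambda>x. indicat_real {x}) ` I)"
  proof (induction I arbitrary: \<omega> rule: finite_induct)
    case empty
    then have "\<omega> = 0" by (intro ext) (simp add: coord_space_def)
    then show ?case by (simp only: span_zero)
  next
    case (insert x I)
    define \<psi> where "\<psi> = (\<lambda>y. if y = x then 0 else \<omega> y)"
    have "\<psi> \<in> coord_space I" using insert.prems by (auto simp: coord_space_def \<psi>_def)
    then have "\<psi> \<in> span ((\<lambda>x. indicat_real {x}) ` insert x I)"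
      by (rule subsetD[OF span_mono[OF image_mono[OF subset_insertI]] insert.IH])
    then have "\<psi> + \<omega> x *\<^sub>R indicat_real {x} \<in> span ((\<lambda>x. indicat_real {x}) ` insert x I)"
      by (intro span_add span_scale span_base[of "indicat_real {x}"]) auto
    moreover have "\<psi> + \<omega> x *\<^sub>R indicat_real {x} = \<omega>"
      by (auto simp: fun_eq_iff plus_fun_def scaleR_fun_def indicator_def \<psi>_def)
    ultimately show ?case by simp
  qed
qed

lemma independent_units: "independent ((\<lambda>x. indicat_real {x}) ` I)"
proof
  assume "dependent ((\<lambda>x. indicat_real {x}) ` I)"
  then obtain x where x: "indicat_real {x} \<in> span ((\<lambda>x. indicat_real {x}) ` I - {indicat_real {x}})"
    by (auto simp: dependent_def)
  \<comment> \<open>The hyperplane where coordinate \<open>x\<close> vanishes contains all other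
    units but not the one at \<open>x\<close>.\<close>
  have "subspace {\<omega>::'a \<Rightarrow> real. \<omega> x = 0}"
    by (auto simp: subspace_def plus_fun_def scaleR_fun_def zero_fun_def)
  moreover have "(\<lambda>x. indicat_real {x}) ` I - {indicat_real {x}} \<subseteq> {\<omega>. \<omega> x = 0}"
    by (auto simp: indicator_def)
  ultimately have "span ((\<lambda>x. indicat_real {x}) ` I - {indicat_real {x}}) \<subseteq> {\<omega>. \<omega> x = 0}"
    by (intro span_minimal)
  then show False using x by auto
qed

lemma card_units: "card ((\<lambda>x. indicat_real {x}) ` I) = card I"
  by (intro card_image inj_onI) (metis indicator_eq_0_iff singletonD singletonI)

text \<open>Turns full dimension into membership of the unit vectors. If
  \<open>dim C = card I\<close>, a unit outside \<open>span C\<close> would extend a basis of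
  \<open>C\<close> to more than \<open>card I\<close> independent vectors in the span of the
  units.\<close>

lemma dim_coord_space_subset:
  assumes "finite I" "C \<subseteq> coord_space I"
  shows "dim C \<le> card I"
    and "dim C = card I \<longleftrightarrow> (\<forall>x\<in>I. indicat_real {x} \<in> span C)"
proof -
  let ?u = "(\<lambda>x. indicat_real {x}) ` I"
  have sub: "C \<subseteq> span ?u" using assms coord_space_subset_span_units by blast
  have fin: "finite ?u" using assms(1) by simp
  show "dim C \<le> card I" using dim_le_card[OF sub fin] unfolding card_units .
  show "dim C = card I \<longleftrightarrow> (\<forall>x\<in>I. indicat_real {x} \<in> span C)"
  proof
    assume eq: "dim C = card I"
    obtain B where B: "B \<subseteq> C" "independent B" "card B = dim C" using basis_exists by metis
    have "finite B"
      using independent_span_bound[OF fin B(2)] B(1) sub by blast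
    show "\<forall>x\<in>I. indicat_real {x} \<in> span C"
    proof (rule ballI, rule ccontr)
      fix x assume x: "x \<in> I" "indicat_real {x} \<notin> span C"
      then have notin: "indicat_real {x} \<notin> span B" using span_mono[OF B(1)] by blast
      then have "independent (insert (indicat_real {x}) B)" using B(2) by (rule independent_insertI)
      moreover have "insert (indicat_real {x}) B \<subseteq> span ?u"
        using x(1) B(1) sub by (auto intro: span_base)
      ultimately have "card (insert (indicat_real {x}) B) \<le> card ?u"
        using independent_span_bound[OF fin] by blast
      moreover have "indicat_real {x} \<notin> B" using notin span_base by blast
      ultimately show False using \<open>finite B\<close> B(3) eq unfolding card_units by simp
    qed
  next
    assume "\<forall>x\<in>I. indicat_real {x} \<in> span C"
    then have "span ?u = span C"
      using sub by (intro span_eq[THEN iffD2]) auto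
    then show "dim C = card I" using dim_eq_card[OF _ independent_units] card_units by metis
  qed
qed

text \<open>Back substitution, by induction on the number of later elements: all members of
  \<open>S\<close> other than \<open>x\<close> come strictly after \<open>x\<close>, so their units
  are already in \<open>W\<close> and can be subtracted from \<open>indicat_real S\<close>.\<close>

lemma units_in_triangular_subspace:
  fixes h :: "'a \<Rightarrow> nat"
  assumes "finite I" "inj_on h I" "subspace W"
    and S: "\<And>x. x \<in> I \<Longrightarrow> \<exists>S\<subseteq>I. x \<in> S \<and> indicat_real S \<in> W \<and> (\<forall>y\<in>S. h x \<le> h y)"
    and "x \<in> I"
  shows "indicat_real {x} \<in> W"
  using \<open>x \<in> I\<close>
proof (induction "card {y \<in> I. h x < h y}" arbitrary: x rule: less_induct)
  case less
  obtain S where S: "S \<subseteq> I" "x \<in> S" "indicat_real S \<in> W" "\<forall>y\<in>S. h x \<le> h y"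
    using assms(4) less.prems by blast
  have "indicat_real {y} \<in> W" if y: "y \<in> S - {x}" for y
  proof -
    have "y \<in> I" using y S(1) by auto
    moreover have "h x \<noteq> h y" using inj_onD[OF assms(2), of x y] y \<open>y \<in> I\<close> less.prems by auto
    then have "h x < h y" using S(4) y by (metis DiffD1 le_neq_implies_less)
    ultimately have "{z \<in> I. h y < h z} \<subset> {z \<in> I. h x < h z}" by auto
    then have "card {z \<in> I. h y < h z} < card {z \<in> I. h x < h z}"
      using assms(1) by (intro psubset_card_mono) auto
    then show ?thesis using less.hyps \<open>y \<in> I\<close> by blast
  qed
  then have "span ((\<lambda>y. indicat_real {y}) ` (S - {x})) \<subseteq> W"
    using assms(3) by (intro span_minimal) auto
  moreover have "indicat_real (S - {x}) \<in> coord_space (S - {x})" by (auto simp: coord_space_def)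
  moreover have "finite (S - {x})" using S(1) assms(1) finite_subset by blast
  ultimately have "indicat_real (S - {x}) \<in> W" using coord_space_subset_span_units by blast
  then have "indicat_real S - indicat_real (S - {x}) \<in> W" using S(3) assms(3) by (intro subspace_diff)
  moreover have "indicat_real S - indicat_real (S - {x}) = indicat_real {x}"
    using S(2) by (auto simp: fun_eq_iff indicator_def)
  ultimately show ?case by simp
qed

text \<open>Writes the step function \<open>\<omega>\<close> as a sum of layers. The truncation
  \<open>f c\<close> is the part of \<open>\<omega>\<close> above level \<open>c\<close>; raising
  \<open>c\<close> to the next value peels off a multiple of the indicator of one superlevel
  set.\<close>

lemma layer_cake:
  fixes \<omega> :: "'a \<Rightarrow> real"
  assumes fin: "finite I" and \<omega>: "\<omega> \<in> coord_space I"
  shows "\<omega> \<in> convex_cone hull ({indicat_real I, - indicat_real I} \<union> (\<lambda>t. indicat_real {x \<in> I. t < \<omega> x}) ` UNIV)"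
    (is "_ \<in> convex_cone hull ?S")
proof -
  define f where "f c = (\<lambda>x. if x \<in> I then max (\<omega> x - c) 0 else 0)" for c
  have f: "f c \<in> convex_cone hull ?S" for c
  proof (induction "card {x \<in> I. c < \<omega> x}" arbitrary: c rule: less_induct)
    case less
    show ?case
    proof (cases "{x \<in> I. c < \<omega> x} = {}")
      case True
      then have "f c = 0" by (auto simp: f_def fun_eq_iff zero_fun_def max_def)
      then show ?thesis by (simp add: convex_cone_hull_contains_0)
    next
      case False
      \<comment> \<open>The next value of \<open>\<omega>\<close> above \<open>c\<close>: between
        the two levels the superlevel set does not change.\<close>
      define m where "m = Min (\<omega> ` {x \<in> I. c < \<omega> x})"
      have "m \<in> \<omega> ` {x \<in> I. c < \<omega> x}" unfolding m_def using fin False by (intro Min_in) auto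
      then obtain y where y: "y \<in> I" "c < \<omega> y" "m = \<omega> y" by auto
      have le: "m \<le> \<omega> x" if "x \<in> I" "c < \<omega> x" for x
        unfolding m_def using that fin by (intro Min_le) auto
      have "{x \<in> I. m < \<omega> x} \<subset> {x \<in> I. c < \<omega> x}" using y by auto
      then have "card {x \<in> I. m < \<omega> x} < card {x \<in> I. c < \<omega> x}"
        using fin by (intro psubset_card_mono) auto
      then have "f m \<in> convex_cone hull ?S" by (rule less)
      moreover have "indicat_real {x \<in> I. c < \<omega> x} \<in> convex_cone hull ?S" by (intro hull_inc) auto
      ultimately have "f m + (m - c) *\<^sub>R indicat_real {x \<in> I. c < \<omega> x} \<in> convex_cone hull ?S"
        using y by (intro convex_cone_hull_add convex_cone_hull_mul) auto
      moreover have "f m + (m - c) *\<^sub>R indicat_real {x \<in> I. c < \<omega> x} = f c"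
      proof
        fix x
        show "(f m + (m - c) *\<^sub>R indicat_real {x \<in> I. c < \<omega> x}) x = f c x"
          using le[of x] y(2,3) by (auto simp: f_def scaleR_fun_def indicator_def max_def)
      qed
      ultimately show ?thesis by simp
    qed
  qed
  \<comment> \<open>A lower bound of \<open>\<omega>\<close>, capped at 0 so that
    \<open>- indicat_real I\<close> receives the nonnegative coefficient \<open>- c\<close>.\<close>
  define c where "c = Min (insert 0 (\<omega> ` I))"
  have c: "c \<le> 0" "\<And>x. x \<in> I \<Longrightarrow> c \<le> \<omega> x" unfolding c_def using fin by auto
  have "- indicat_real I \<in> convex_cone hull ?S" by (intro hull_inc) auto
  then have "f c + (- c) *\<^sub>R (- indicat_real I) \<in> convex_cone hull ?S"
    using f c by (intro convex_cone_hull_add convex_cone_hull_mul) auto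
  moreover have "f c + (- c) *\<^sub>R (- indicat_real I) = \<omega>"
  proof
    fix x
    show "(f c + (- c) *\<^sub>R (- indicat_real I)) x = \<omega> x"
      using c(2)[of x] \<omega> by (auto simp: f_def scaleR_fun_def indicator_def coord_space_def)
  qed
  ultimately show ?thesis by simp
qed

text \<open>Complements occur because the coordinates in \<open>flag_cone\<close> grow along the
  flag. Both signs of \<open>indicat_real I\<close> occur because a cone hull has only nonnegative
  multiples, whereas constants may be negative.\<close>

definition flag_gens :: "'a set \<Rightarrow> 'a set set \<Rightarrow> ('a \<Rightarrow> real) set" where
  "flag_gens I \<F> = {indicat_real I, - indicat_real I} \<union> (\<lambda>F. indicat_real (I - F)) ` \<F>"

text \<open>The inequality and the equality condition merge into one monotonicity condition, since
  equal minimal members are included in each other both ways.\<close>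

lemma mem_flag_cone_iff:
  "\<omega> \<in> flag_cone E \<F> \<longleftrightarrow> \<omega> \<in> coord_space E \<and>
    (\<forall>e\<in>E. \<forall>f\<in>E. flag_min E \<F> e \<subseteq> flag_min E \<F> f \<longrightarrow> \<omega> e \<le> \<omega> f)"
  (is "_ \<longleftrightarrow> _ \<and> ?mono")
proof -
  let ?m = "flag_min E \<F>"
  have "?mono \<longleftrightarrow> (\<forall>e\<in>E. \<forall>f\<in>E. (?m e \<subset> ?m f \<longrightarrow> \<omega> e \<le> \<omega> f) \<and> (?m e = ?m f \<longrightarrow> \<omega> e = \<omega> f))"
    (is "_ \<longleftrightarrow> ?strict")
  proof (intro iffI ballI conjI impI)
    fix e f assume "?mono" "e \<in> E" "f \<in> E" "?m e \<subset> ?m f"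
    then show "\<omega> e \<le> \<omega> f" by blast
  next
    fix e f assume "?mono" "e \<in> E" "f \<in> E" "?m e = ?m f"
    then have "\<omega> e \<le> \<omega> f" "\<omega> f \<le> \<omega> e" by blast+
    then show "\<omega> e = \<omega> f" by (rule antisym)
  next
    fix e f assume "?strict" "e \<in> E" "f \<in> E" and sub: "?m e \<subseteq> ?m f"
    then have "?m e \<subset> ?m f \<longrightarrow> \<omega> e \<le> \<omega> f" "?m e = ?m f \<longrightarrow> \<omega> e = \<omega> f" by blast+
    with sub show "\<omega> e \<le> \<omega> f" by (cases "?m e = ?m f") auto
  qed
  then show ?thesis by (simp only: flag_cone_def mem_Collect_eq)
qed

lemma convex_cone_flag_cone: "convex_cone (flag_cone E \<F>)"
  unfolding convex_cone_iff
proof (intro conjI ballI allI impI)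
  show "0 \<in> flag_cone E \<F>" by (simp add: mem_flag_cone_iff coord_space_def)
next
  fix x y assume xy: "x \<in> flag_cone E \<F>" "y \<in> flag_cone E \<F>"
  then have "x + y \<in> coord_space E" by (intro subspace_add subspace_coord_space) (auto simp: mem_flag_cone_iff)
  with xy show "x + y \<in> flag_cone E \<F>" unfolding mem_flag_cone_iff by (simp add: add_mono)
next
  fix x and c :: real assume xc: "x \<in> flag_cone E \<F>" "0 \<le> c"
  then have "c *\<^sub>R x \<in> coord_space E" by (intro subspace_scale subspace_coord_space) (auto simp: mem_flag_cone_iff)
  with xc show "c *\<^sub>R x \<in> flag_cone E \<F>"
    unfolding mem_flag_cone_iff by (simp add: scaleR_fun_def mult_left_mono)
qed

lemma coord_proj_flag_gens:
  assumes "A \<subseteq> I"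
  shows "coord_proj A ` flag_gens I \<F> = flag_gens A \<F>"
proof -
  have "A \<inter> I = A" "\<And>F. A \<inter> (I - F) = A - F" using assms by auto
  then show ?thesis
    by (simp add: flag_gens_def image_Un image_image coord_proj_indicator linear_neg[OF linear_coord_proj])
qed

section \<open>Generators of projected flag cones and traces of a flag\<close>

context finite_rank_matroid
begin

text \<open>If \<open>f\<close> lies in a member \<open>F\<close>, so does all of
  \<open>flag_min E \<F> f\<close>. Hence \<open>F\<close> is closed downwards for the order
  defining the cone, and the indicator of its complement is increasing.\<close>

lemma flag_gens_subset_flag_cone:
  assumes "flag_of_flats E indep \<F>"
  shows "flag_gens E \<F> \<subseteq> flag_cone E \<F>"
proof -
  have "indicat_real (E - F) \<in> flag_cone E \<F>" if F: "F \<in> \<F>" for F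
  proof -
    have "indicat_real (E - F) e \<le> indicat_real (E - F) f"
      if e: "e \<in> E" and f: "f \<in> E" and sub: "flag_min E \<F> e \<subseteq> flag_min E \<F> f" for e f
    proof (cases "f \<in> F")
      case True
      then have "flag_min E \<F> f \<subseteq> F" using flag_min_props(3)[OF assms f, of F] F by simp
      then have "e \<in> F" using flag_min_props(2)[OF assms e] sub by blast
      then show ?thesis by simp
    qed (simp add: f)
    then show ?thesis by (simp add: mem_flag_cone_iff coord_space_def)
  qed
  moreover have "indicat_real E \<in> flag_cone E \<F>" "- indicat_real E \<in> flag_cone E \<F>"
    by (simp_all add: mem_flag_cone_iff coord_space_def)
  ultimately show ?thesis unfolding flag_gens_def by blast
qed

text \<open>Among the finitely many minimal members of elements with
  \<open>\<omega> x \<le> t\<close>, take the largest, \<open>F\<close>. Monotonicity of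
  \<open>\<omega>\<close> along the chain makes \<open>I \<inter> F\<close> exactly the set of these
  elements.\<close>

lemma flag_cone_sublevel:
  assumes flag: "flag_of_flats E indep \<F>" and I: "finite I" "I \<subseteq> E" and \<omega>: "\<omega> \<in> flag_cone E \<F>"
  shows "{x \<in> I. t < \<omega> x} \<in> {{}, I} \<union> (\<lambda>F. I - F) ` \<F>"
proof (cases "{x \<in> I. \<omega> x \<le> t} = {}")
  case True
  then have "{x \<in> I. t < \<omega> x} = I" by (auto simp: not_le)
  then show ?thesis by simp
next
  case False
  let ?L = "{x \<in> I. \<omega> x \<le> t}"
  let ?m = "flag_min E \<F>"
  have "finite (?m ` ?L)" using I by simp
  then obtain F where "F \<in> ?m ` ?L" and max: "\<And>G. G \<in> ?m ` ?L \<Longrightarrow> F \<subseteq> G \<Longrightarrow> G = F"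
    using finite_has_maximal[of "?m ` ?L"] False unfolding image_is_empty by blast
  then obtain d where d: "d \<in> I" "\<omega> d \<le> t" "F = ?m d" by auto
  have props: "x \<in> ?m x" "?m x \<in> insert E \<F>" "\<And>F. F \<in> insert E \<F> \<Longrightarrow> x \<in> F \<Longrightarrow> ?m x \<subseteq> F"
    if "x \<in> I" for x
    using flag_min_props[OF flag, of x] that I by auto
  have mono: "\<omega> x \<le> \<omega> y" if "x \<in> I" "y \<in> I" "?m x \<subseteq> ?m y" for x y
    using \<omega> that I(2) unfolding mem_flag_cone_iff by blast
  have chain: "A \<subseteq> B \<or> B \<subseteq> A" if "A \<in> insert E \<F>" "B \<in> insert E \<F>" for A B
    using that flag by (auto simp: flag_of_flats_def chain_subset_def flat_def)
  have "x \<in> F \<longleftrightarrow> \<omega> x \<le> t" if x: "x \<in> I" for x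
  proof
    assume "x \<in> F"
    then have "?m x \<subseteq> ?m d" using props(3)[OF x] props(2)[OF d(1)] d(3) by simp
    then show "\<omega> x \<le> t" using mono[OF x d(1)] d(2) by simp
  next
    assume "\<omega> x \<le> t"
    then have "?m x \<in> ?m ` ?L" using x by auto
    then have "?m x \<subseteq> F" using chain[OF props(2)[OF x] props(2)[OF d(1)]] max d(3) by blast
    then show "x \<in> F" using props(1)[OF x] by blast
  qed
  then have "{x \<in> I. t < \<omega> x} = I - F" by (auto simp: not_le[symmetric])
  \<comment> \<open>\<open>F\<close> may be the added top \<open>E\<close> instead of a member of
    the flag; the superlevel set is then empty.\<close>
  moreover have "F = E \<or> F \<in> \<F>" using props(2)[OF d(1)] d(3) by auto
  ultimately show ?thesis using I(2) by auto
qed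

text \<open>One inclusion projects the generators from \<open>E\<close> to \<open>I\<close>. The
  other is \<open>layer_cake\<close>, as the superlevel sets are the complements occurring in
  \<open>flag_gens\<close>, up to the trivial ones.\<close>

lemma coord_proj_flag_cone:
  assumes flag: "flag_of_flats E indep \<F>" and I: "finite I" "I \<subseteq> E"
  shows "coord_proj I ` flag_cone E \<F> = convex_cone hull flag_gens I \<F>"
proof
  show "convex_cone hull flag_gens I \<F> \<subseteq> coord_proj I ` flag_cone E \<F>"
  proof (rule hull_minimal)
    show "flag_gens I \<F> \<subseteq> coord_proj I ` flag_cone E \<F>"
      unfolding coord_proj_flag_gens[OF I(2), symmetric]
      by (rule image_mono[OF flag_gens_subset_flag_cone[OF flag]])
    show "convex_cone (coord_proj I ` flag_cone E \<F>)"
      by (intro convex_cone_linear_image conjI convex_cone_flag_cone linear_coord_proj)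
  qed
  show "coord_proj I ` flag_cone E \<F> \<subseteq> convex_cone hull flag_gens I \<F>"
  proof (rule image_subsetI)
    fix \<omega> assume \<omega>: "\<omega> \<in> flag_cone E \<F>"
    let ?p = "coord_proj I \<omega>"
    \<comment> \<open>The empty superlevel set contributes the zero vector, which is in the hull but
      need not be a generator; hence \<open>insert 0\<close>.\<close>
    have "indicat_real {x \<in> I. t < ?p x} \<in> insert 0 (flag_gens I \<F>)" for t
    proof -
      have "{x \<in> I. t < ?p x} = {x \<in> I. t < \<omega> x}" by (auto simp: coord_proj_def)
      moreover have "indicat_real ` ({{}, I} \<union> (\<lambda>F. I - F) ` \<F>) \<subseteq> insert 0 (flag_gens I \<F>)"
        by (auto simp: flag_gens_def zero_fun_def)
      ultimately show ?thesis using flag_cone_sublevel[OF flag I \<omega>, of t] by auto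
    qed
    moreover have "indicat_real I \<in> flag_gens I \<F>" "- indicat_real I \<in> flag_gens I \<F>"
      by (simp_all add: flag_gens_def)
    ultimately have "{indicat_real I, - indicat_real I} \<union> (\<lambda>t. indicat_real {x \<in> I. t < ?p x}) ` UNIV
        \<subseteq> insert 0 (flag_gens I \<F>)"
      by blast
    also have "\<dots> \<subseteq> convex_cone hull flag_gens I \<F>"
      by (intro insert_subsetI convex_cone_hull_contains_0 hull_subset)
    finally have "convex_cone hull ({indicat_real I, - indicat_real I} \<union>
        (\<lambda>t. indicat_real {x \<in> I. t < ?p x}) ` UNIV) \<subseteq> convex_cone hull flag_gens I \<F>"
      using convex_cone_convex_cone_hull by (rule hull_minimal)
    moreover have "?p \<in> coord_space I" by (auto simp: coord_proj_def coord_space_def)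
    ultimately show "?p \<in> convex_cone hull flag_gens I \<F>" using layer_cake[OF I(1)] by blast
  qed
qed

text \<open>Along the chain the sets \<open>A \<inter> F\<close> strictly gain rank whenever they
  grow, and the nonempty ones have positive rank by looplessness. So the nontrivial traces inject
  into \<open>{1..<matroid_rank indep A}\<close>.\<close>

lemma card_flag_traces:
  assumes flag: "flag_of_flats E indep \<F>" and ll: "loopless E indep"
    and A: "finite A" "A \<subseteq> E" "A \<noteq> {}"
  shows "card ((\<lambda>F. A - F) ` \<F> - {{}, A}) < matroid_rank indep A"
proof -
  let ?T = "(\<lambda>F. A - F) ` \<F> - {{}, A}" and ?r = "matroid_rank indep"
  have pos: "0 < ?r B" if B: "B \<subseteq> A" "B \<noteq> {}" for B
  proof -
    obtain b where "b \<in> B" using B by blast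
    then show ?thesis using card_le_rank[of "{b}" B] B A ll by (auto simp: loopless_def)
  qed
  have less: "?r (A \<inter> F) < ?r (A \<inter> G)" if FG: "F \<in> \<F>" "A \<inter> F \<subset> A \<inter> G" for F G
  proof -
    obtain x where x: "x \<in> A \<inter> G" "x \<notin> F" using FG by blast
    have "?r (A \<inter> F) < ?r (insert x (A \<inter> F))"
      using x FG flag A by (intro flat_not_spanned[of F]) (auto simp: flag_of_flats_def)
    also have "\<dots> \<le> ?r (A \<inter> G)" using x FG by (intro rank_mono) auto
    finally show ?thesis .
  qed
  have inj: "inj_on (\<lambda>U. ?r (A - U)) ?T"
  proof (rule inj_onI)
    fix U V assume U: "U \<in> ?T" and V: "V \<in> ?T" and eq: "?r (A - U) = ?r (A - V)"
    obtain F where F: "F \<in> \<F>" "U = A - F" using U by auto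
    obtain G where G: "G \<in> \<F>" "V = A - G" using V by auto
    have AF: "A - U = A \<inter> F" "A - V = A \<inter> G" using F G by auto
    have "F \<subseteq> G \<or> G \<subseteq> F" using F G flag by (auto simp: flag_of_flats_def chain_subset_def)
    then have "A \<inter> F = A \<inter> G"
      using less[OF F(1), of G] less[OF G(1), of F] eq unfolding AF by auto
    then show "U = V" using F G by auto
  qed
  have "(\<lambda>U. ?r (A - U)) ` ?T \<subseteq> {1..<?r A}"
  proof (rule image_subsetI)
    fix U assume "U \<in> ?T"
    then obtain F where F: "F \<in> \<F>" "U = A - F" "A - F \<noteq> {}" "A - F \<noteq> A" by auto
    have "A - U = A \<inter> F" using F by auto
    \<comment> \<open>\<open>less\<close> asks only its first set to belong to the flag, so
      \<open>UNIV\<close> can stand for the top trace \<open>A\<close>.\<close>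
    moreover have "?r (A \<inter> F) < ?r (A \<inter> UNIV)" using F by (intro less) auto
    moreover have "0 < ?r (A \<inter> F)" using F by (intro pos) auto
    ultimately show "?r (A - U) \<in> {1..<?r A}" by simp
  qed
  then have "card ?T \<le> card {1..<?r A}" using inj by (intro card_inj_on_le) auto
  then show ?thesis using pos[of A] A by simp
qed

end

section \<open>Dimension of the projected sum of Bergman fans\<close>

lemma span_convex_cone_hull: "span (convex_cone hull S) = span S"
proof
  have "convex_cone hull S \<subseteq> span S" using span_superset convex_cone_span by (rule hull_minimal)
  then show "span (convex_cone hull S) \<subseteq> span S" by (rule span_minimal[OF _ subspace_span])
qed (rule span_mono[OF hull_subset])

text \<open>The projected sum is the union, over pairs of flags, of the cones generated by both sets
  of generators. Its dimension is the largest among these cones and at most \<open>card I\<close>,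
  so it equals \<open>card I\<close> iff some pair spans all units.\<close>

lemma cones_dim_bergman_sum_eq_card_iff:
  assumes M: "finite_rank_matroid E M" and N: "finite_rank_matroid E N"
    and I: "finite I" "I \<subseteq> E"
  shows "cones_dim (coord_proj I ` (bergman_fan E M + bergman_fan E N)) = card I \<longleftrightarrow>
    (\<exists>\<F> \<G>. flag_of_flats E M \<F> \<and> flag_of_flats E N \<G> \<and>
      (\<forall>x\<in>I. indicat_real {x} \<in> span (flag_gens I \<F> \<union> flag_gens I \<G>)))"
proof -
  interpret M: finite_rank_matroid E M by (rule M)
  interpret N: finite_rank_matroid E N by (rule N)
  define P where "P = {\<F>. flag_of_flats E M \<F>} \<times> {\<G>. flag_of_flats E N \<G>}"
  define C where "C = (\<lambda>(\<F>, \<G>). convex_cone hull (flag_gens I \<F> \<union> flag_gens I \<G>))"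
  have add: "coord_proj I (\<omega> + \<psi>) = coord_proj I \<omega> + coord_proj I \<psi>" for \<omega> \<psi>
    by (rule linear_add[OF linear_coord_proj])
  have C: "C (\<F>, \<G>) = {coord_proj I (\<omega> + \<psi>) | \<omega> \<psi>. \<omega> \<in> flag_cone E \<F> \<and> \<psi> \<in> flag_cone E \<G>}"
    if "(\<F>, \<G>) \<in> P" for \<F> \<G>
  proof -
    have "flag_of_flats E M \<F>" "flag_of_flats E N \<G>" using that by (auto simp: P_def)
    then have "convex_cone hull flag_gens I \<F> = coord_proj I ` flag_cone E \<F>"
      "convex_cone hull flag_gens I \<G> = coord_proj I ` flag_cone E \<G>"
      using M.coord_proj_flag_cone[OF _ I] N.coord_proj_flag_cone[OF _ I] by simp_all
    then show ?thesis unfolding C_def prod.case convex_cone_hull_Un add by auto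
  qed
  have union: "coord_proj I ` (bergman_fan E M + bergman_fan E N) = \<Union>(C ` P)"
  proof (intro equalityI subsetI)
    fix x assume "x \<in> coord_proj I ` (bergman_fan E M + bergman_fan E N)"
    then obtain \<omega> \<psi> where "x = coord_proj I (\<omega> + \<psi>)" "\<omega> \<in> bergman_fan E M" "\<psi> \<in> bergman_fan E N"
      by (auto elim!: set_plus_elim)
    then obtain \<F> \<G> where "(\<F>, \<G>) \<in> P" "\<omega> \<in> flag_cone E \<F>" "\<psi> \<in> flag_cone E \<G>"
      by (auto simp: bergman_fan_def P_def)
    with \<open>x = _\<close> have "x \<in> C (\<F>, \<G>)" using C by blast
    with \<open>(\<F>, \<G>) \<in> P\<close> show "x \<in> \<Union>(C ` P)" by blast
  next
    fix x assume "x \<in> \<Union>(C ` P)"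
    then obtain \<F> \<G> where FG: "(\<F>, \<G>) \<in> P" "x \<in> C (\<F>, \<G>)" by auto
    then obtain \<omega> \<psi> where x: "x = coord_proj I (\<omega> + \<psi>)" "\<omega> \<in> flag_cone E \<F>" "\<psi> \<in> flag_cone E \<G>"
      using C by blast
    have "\<omega> \<in> bergman_fan E M" "\<psi> \<in> bergman_fan E N"
      using x FG(1) by (auto simp: bergman_fan_def P_def)
    then show "x \<in> coord_proj I ` (bergman_fan E M + bergman_fan E N)"
      unfolding x(1) by (intro imageI set_plus_intro)
  qed
  \<comment> \<open>There may be infinitely many flags, but all their generators on \<open>I\<close>
    lie in this finite set, so only finitely many cones arise, as \<open>cones_dim_Union\<close>
    requires.\<close>
  let ?U = "{indicat_real I, - indicat_real I} \<union> indicat_real ` Pow I"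
  have finU: "finite ?U" using I(1) by simp
  have gens: "flag_gens I \<F> \<subseteq> ?U" for \<F> by (auto simp: flag_gens_def)
  have "C ` P \<subseteq> (\<lambda>S. convex_cone hull S) ` Pow ?U" using gens by (fastforce simp: C_def)
  then have fin: "finite (C ` P)" by (rule finite_subset) (use finU in simp)
  have "({}, {}) \<in> P" by (simp add: P_def flag_of_flats_def chain_subset_def)
  then have ne: "C ` P \<noteq> {}" by blast
  have "finite (flag_gens I \<F> \<union> flag_gens I \<G>)" for \<F> \<G>
    using finite_subset[OF gens finU] by simp
  then have "polyhedral_cone (C p)" for p
    unfolding polyhedral_cone_def C_def case_prod_beta by blast
  then have poly: "\<forall>K\<in>C ` P. polyhedral_cone K" by blast
  have sub: "K \<subseteq> coord_space I" if "K \<in> C ` P" for K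
  proof -
    obtain \<F> \<G> where FG: "(\<F>, \<G>) \<in> P" "K = C (\<F>, \<G>)" using \<open>K \<in> C ` P\<close> by auto
    have "coord_proj I \<omega> \<in> coord_space I" for \<omega> by (simp add: coord_proj_def coord_space_def)
    then show ?thesis unfolding FG(2) C[OF FG(1)] by blast
  qed
  have le: "\<forall>K\<in>C ` P. dim K \<le> card I" using dim_coord_space_subset(1)[OF I(1) sub] by blast
  have "cones_dim (\<Union>(C ` P)) = card I \<longleftrightarrow> (\<exists>K\<in>C ` P. dim K = card I)"
  proof -
    have "Max (dim ` C ` P) = card I \<longleftrightarrow> card I \<in> dim ` C ` P \<and> (\<forall>d\<in>dim ` C ` P. d \<le> card I)"
      using fin ne by (intro Max_eq_iff) auto
    also have "\<dots> \<longleftrightarrow> (\<exists>K\<in>C ` P. dim K = card I)" using le unfolding image_iff by force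
    finally show ?thesis unfolding cones_dim_Union[OF fin ne poly] .
  qed
  also have "\<dots> \<longleftrightarrow> (\<exists>K\<in>C ` P. \<forall>x\<in>I. indicat_real {x} \<in> span K)"
    using dim_coord_space_subset(2)[OF I(1) sub] by blast
  also have "\<dots> \<longleftrightarrow> (\<exists>\<F> \<G>. flag_of_flats E M \<F> \<and> flag_of_flats E N \<G> \<and>
      (\<forall>x\<in>I. indicat_real {x} \<in> span (flag_gens I \<F> \<union> flag_gens I \<G>)))"
    by (simp add: P_def C_def span_convex_cone_hull)
  finally show ?thesis by (simp only: union)
qed

section \<open>Spanning flags and the rank inequality on subsets\<close>

context finite_rank_matroid
begin

text \<open>Separates \<open>indicat_real A\<close> from the rest so that two flags can share it.
  The trivial traces \<open>{}\<close> and \<open>A\<close> add nothing to \<open>T\<close>: they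
  give the zero vector and \<open>indicat_real A\<close> itself.\<close>

lemma flag_gens_in_small_span:
  assumes flag: "flag_of_flats E indep \<F>" and ll: "loopless E indep"
    and A: "finite A" "A \<subseteq> E" "A \<noteq> {}"
  obtains T where "finite T" "card T < matroid_rank indep A"
    "flag_gens A \<F> \<subseteq> span (insert (indicat_real A) T)"
proof
  let ?T = "(\<lambda>F. A - F) ` \<F> - {{}, A}"
  have fin: "finite ?T" by (rule finite_subset[of _ "Pow A"]) (use A in auto)
  then show "finite (indicat_real ` ?T)" by simp
  show "card (indicat_real ` ?T) < matroid_rank indep A"
    using card_image_le[OF fin] card_flag_traces[OF assms] by (rule le_less_trans)
  have "indicat_real U \<in> span (insert (indicat_real A) (indicat_real ` ?T))"
    if "U \<in> (\<lambda>F. A - F) ` \<F>" for U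
  proof (cases "U \<in> {{}, A}")
    case False
    then show ?thesis using that by (intro span_base) auto
  next
    case True
    moreover have "indicat_real {} = 0" by (intro ext) simp
    ultimately show ?thesis using span_zero span_base by (metis insertE insertI1 singletonD)
  qed
  moreover have "indicat_real A \<in> span (insert (indicat_real A) (indicat_real ` ?T))"
    by (intro span_base) auto
  moreover from this have "- indicat_real A \<in> span (insert (indicat_real A) (indicat_real ` ?T))"
    by (rule span_neg)
  ultimately show "flag_gens A \<F> \<subseteq> span (insert (indicat_real A) (indicat_real ` ?T))"
    by (auto simp: flag_gens_def)
qed

text \<open>The flag consists of the spans of \<open>B \<inter> {h \<ge> k}\<close>; as \<open>y\<close> is not spanned by the rest of
  \<open>B \<inter> {h \<ge> h y}\<close>, it avoids the spans of all later segments.\<close>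

lemma triangular_flag:
  fixes h :: "'a \<Rightarrow> nat"
  assumes B: "indep B" and I: "I \<subseteq> E"
    and ins: "\<And>x. x \<in> I \<Longrightarrow> indep (insert x (B \<inter> {y \<in> I. h x \<le> h y}))"
  obtains \<F> where "flag_of_flats E indep \<F>"
    "\<And>x. x \<in> B \<inter> I \<Longrightarrow> \<exists>F\<in>\<F>. x \<in> F \<and> (\<forall>y\<in>I \<inter> F. h x \<le> h y)"
proof
  define F where "F k = span_of (B \<inter> {y \<in> I. k \<le> h y})" for k
  have indepF: "indep (B \<inter> {y \<in> I. k \<le> h y})" for k using B by (rule indep_subset) auto
  have anti: "F l \<subseteq> F k" if "k \<le> l" for k l
    unfolding F_def using that by (intro span_of_mono) auto
  \<comment> \<open>The span of a late segment may be empty, and flags admit only nonempty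
    flats.\<close>
  show "flag_of_flats E indep (range F - {{}})"
    unfolding flag_of_flats_def
  proof (intro conjI ballI)
    fix G assume "G \<in> range F - {{}}"
    then show "flat E indep G" "G \<noteq> {}" using flat_span_of[OF indepF] by (auto simp: F_def)
  next
    have "F k \<subseteq> F l \<or> F l \<subseteq> F k" for k l using nat_le_linear[of k l] anti by blast
    then show "chain\<^sub>\<subseteq> (range F - {{}})" by (auto simp: chain_subset_def)
  qed
  fix x assume x: "x \<in> B \<inter> I"
  have "x \<in> F (h x)" using x I by (auto simp: F_def span_of_def)
  moreover have "h x \<le> h y" if y: "y \<in> I \<inter> F (h x)" for y
  proof (rule ccontr)
    assume less: "\<not> h x \<le> h y"
    then have "\<not> indep (insert y (B \<inter> {z \<in> I. h x \<le> h z}))"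
      using y by (auto simp: F_def span_of_def)
    moreover have "insert y (B \<inter> {z \<in> I. h x \<le> h z}) \<subseteq> insert y (B \<inter> {z \<in> I. h y \<le> h z})"
      using less by auto
    ultimately show False using ins[of y] y indep_subset by blast
  qed
  ultimately show "\<exists>G\<in>range F - {{}}. x \<in> G \<and> (\<forall>y\<in>I \<inter> G. h x \<le> h y)" by blast
qed

end

lemma exists_spanning_flags:
  assumes M: "finite_rank_matroid E M" and N: "finite_rank_matroid E N"
    and I: "finite I" "I \<subseteq> E"
    and le: "\<And>A. A \<subseteq> I \<Longrightarrow> A \<noteq> {} \<Longrightarrow> card A < matroid_rank M A + matroid_rank N A"
  shows "\<exists>\<F> \<G>. flag_of_flats E M \<F> \<and> flag_of_flats E N \<G> \<and>
      (\<forall>x\<in>I. indicat_real {x} \<in> span (flag_gens I \<F> \<union> flag_gens I \<G>))"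
proof -
  interpret M: finite_rank_matroid E M by (rule M)
  interpret N: finite_rank_matroid E N by (rule N)
  have "\<exists>B C. M B \<and> N C \<and> B \<union> C = I \<union> {} \<union> {}"
  proof (rule matroid_union_cover[OF M N])
    fix A assume "A \<subseteq> I"
    then show "card A + card ({}::'a set) + card ({}::'a set)
        \<le> matroid_rank M (A \<union> {}) + matroid_rank N (A \<union> {})"
      using le[of A] by (cases "A = {}") auto
  qed (use I in auto)
  then obtain B C where B: "M B" and C: "N C" and BC: "B \<union> C = I" by auto
  have "\<exists>x\<in>X. M (insert x (B \<inter> X)) \<and> N (insert x (C \<inter> X))" if X: "X \<subseteq> I" "X \<noteq> {}" for X
  proof (rule ccontr)
    assume neg: "\<not> ?thesis"
    have finX: "finite X" using X I finite_subset by blast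
    have BX: "M (B \<inter> X)" and CX: "N (C \<inter> X)"
      using B C by (auto intro: M.indep_subset N.indep_subset)
    have B_ins: "M (insert x (B \<inter> X))" if "x \<in> B" "x \<in> X" for x
      using BX that by (simp add: insert_absorb)
    have C_ins: "N (insert x (C \<inter> X))" if "x \<in> C" "x \<in> X" for x
      using CX that by (simp add: insert_absorb)
    have disj: "(B \<inter> X) \<inter> (C \<inter> X) = {}" using neg B_ins C_ins by blast
    have cover: "x \<in> B \<or> x \<in> C" if "x \<in> X" for x using that X BC by blast
    \<comment> \<open>A larger independent set in \<open>X\<close> would augment
      \<open>B \<inter> X\<close> by some \<open>x\<close> outside \<open>B\<close>. Then
      \<open>x\<close> lies in \<open>C\<close>, inserting it into \<open>C \<inter> X\<close>
      changes nothing, and \<open>neg\<close> is violated.\<close>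
    have rM: "matroid_rank M X \<le> card (B \<inter> X)"
    proof (rule ccontr)
      assume "\<not> ?thesis"
      moreover obtain J where "J \<subseteq> X" "M J" "card J = matroid_rank M X" by (rule M.rank_attained)
      ultimately obtain x where "x \<in> X" "x \<notin> B \<inter> X" "M (insert x (B \<inter> X))"
        using M.indep_augment[OF BX, of J] by auto
      then show False using neg C_ins cover by blast
    qed
    have rN: "matroid_rank N X \<le> card (C \<inter> X)"
    proof (rule ccontr)
      assume "\<not> ?thesis"
      moreover obtain J where "J \<subseteq> X" "N J" "card J = matroid_rank N X" by (rule N.rank_attained)
      ultimately obtain x where "x \<in> X" "x \<notin> C \<inter> X" "N (insert x (C \<inter> X))"
        using N.indep_augment[OF CX, of J] by auto
      then show False using neg B_ins cover by blast
    qed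
    have "card (B \<inter> X) + card (C \<inter> X) = card ((B \<inter> X) \<union> (C \<inter> X))"
      using finX disj by (intro card_Un_disjoint[symmetric]) auto
    also have "(B \<inter> X) \<union> (C \<inter> X) = X" using cover by blast
    \<comment> \<open>The two ranks add up to at most \<open>card X\<close>, against the strict
      inequality \<open>le\<close>.\<close>
    finally show False using rM rN le[OF X] by simp
  qed
  \<comment> \<open>The order of removal: the sets \<open>X\<close> from which elements are selected
    become the final segments of \<open>h\<close>.\<close>
  from enumerate_by_selection[OF I(1) this] obtain h :: "'a \<Rightarrow> nat" where h: "inj_on h I"
    and ins: "\<And>x. x \<in> I \<Longrightarrow> M (insert x (B \<inter> {y \<in> I. h x \<le> h y}))"
      "\<And>x. x \<in> I \<Longrightarrow> N (insert x (C \<inter> {y \<in> I. h x \<le> h y}))"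
    by blast
  obtain \<F> where \<F>: "flag_of_flats E M \<F>"
    "\<And>x. x \<in> B \<inter> I \<Longrightarrow> \<exists>F\<in>\<F>. x \<in> F \<and> (\<forall>y\<in>I \<inter> F. h x \<le> h y)"
    using M.triangular_flag[OF B I(2) ins(1)] by blast
  obtain \<G> where \<G>: "flag_of_flats E N \<G>"
    "\<And>x. x \<in> C \<inter> I \<Longrightarrow> \<exists>F\<in>\<G>. x \<in> F \<and> (\<forall>y\<in>I \<inter> F. h x \<le> h y)"
    using N.triangular_flag[OF C I(2) ins(2)] by blast
  let ?W = "span (flag_gens I \<F> \<union> flag_gens I \<G>)"
  \<comment> \<open>Passes from complements to intersections: for the members supplied by
    \<open>triangular_flag\<close>, \<open>I \<inter> F\<close> contains \<open>x\<close> and only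
    elements from position \<open>h x\<close> on.\<close>
  have W: "indicat_real (I \<inter> F) \<in> ?W" if "F \<in> \<F> \<union> \<G>" for F
  proof -
    have "indicat_real I - indicat_real (I - F) \<in> ?W"
      using that by (intro span_diff span_base) (auto simp: flag_gens_def)
    moreover have "indicat_real I - indicat_real (I - F) = indicat_real (I \<inter> F)"
      by (auto simp: fun_eq_iff indicator_def)
    ultimately show ?thesis by simp
  qed
  have "\<exists>S\<subseteq>I. x \<in> S \<and> indicat_real S \<in> ?W \<and> (\<forall>y\<in>S. h x \<le> h y)" if x: "x \<in> I" for x
  proof -
    have "x \<in> B \<inter> I \<or> x \<in> C \<inter> I" using x BC by blast
    then obtain F where "F \<in> \<F> \<union> \<G>" "x \<in> F" "\<forall>y\<in>I \<inter> F. h x \<le> h y"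
      using \<F>(2) \<G>(2) by blast
    then show ?thesis using W x by (intro exI[of _ "I \<inter> F"]) auto
  qed
  then have "indicat_real {x} \<in> ?W" if "x \<in> I" for x
    using units_in_triangular_subspace[OF I(1) h subspace_span _ that] by blast
  then show ?thesis using \<F>(1) \<G>(1) by blast
qed

text \<open>Projection to \<open>A\<close> maps the generators on \<open>I\<close> to those on
  \<open>A\<close> and keeps the units of \<open>A\<close>. These independent vectors then lie in
  the span of \<open>?D\<close>, which bounds their number.\<close>

lemma card_less_rank_sum_if_spanning_flags:
  assumes M: "finite_rank_matroid E M" "loopless E M" and N: "finite_rank_matroid E N" "loopless E N"
    and I: "finite I" "I \<subseteq> E"
    and flags: "flag_of_flats E M \<F>" "flag_of_flats E N \<G>"
    and units: "\<And>x. x \<in> I \<Longrightarrow> indicat_real {x} \<in> span (flag_gens I \<F> \<union> flag_gens I \<G>)"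
    and A: "A \<subseteq> I" "A \<noteq> {}"
  shows "card A < matroid_rank M A + matroid_rank N A"
proof -
  have finA: "finite A" "A \<subseteq> E" using A I finite_subset by auto
  obtain S where S: "finite S" "card S < matroid_rank M A"
    "flag_gens A \<F> \<subseteq> span (insert (indicat_real A) S)"
    by (rule finite_rank_matroid.flag_gens_in_small_span[OF M(1) flags(1) M(2) finA A(2)])
  obtain T where T: "finite T" "card T < matroid_rank N A"
    "flag_gens A \<G> \<subseteq> span (insert (indicat_real A) T)"
    by (rule finite_rank_matroid.flag_gens_in_small_span[OF N(1) flags(2) N(2) finA A(2)])
  \<comment> \<open>Both flags share \<open>indicat_real A\<close>, so it is counted once:
    \<open>?D\<close> has at most \<open>1 + (matroid_rank M A - 1) + (matroid_rank N A - 1)\<close>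
    elements.\<close>
  let ?D = "insert (indicat_real A) (S \<union> T)"
  have sub: "flag_gens A \<F> \<union> flag_gens A \<G> \<subseteq> span ?D"
    using S(3) T(3) span_mono[of "insert (indicat_real A) S" ?D]
      span_mono[of "insert (indicat_real A) T" ?D] by blast
  have "indicat_real {x} \<in> span ?D" if x: "x \<in> A" for x
  proof -
    have "coord_proj A (indicat_real {x}) \<in> coord_proj A ` span (flag_gens I \<F> \<union> flag_gens I \<G>)"
      using units x A by blast
    also have "\<dots> = span (flag_gens A \<F> \<union> flag_gens A \<G>)"
      by (simp add: linear_span_image[OF linear_coord_proj, symmetric] image_Un coord_proj_flag_gens[OF A(1)])
    also have "\<dots> \<subseteq> span ?D" by (rule span_minimal[OF sub subspace_span])
    finally show ?thesis using x by (simp add: coord_proj_indicator)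
  qed
  then have "card ((\<lambda>x. indicat_real {x}) ` A) \<le> card ?D"
    using S(1) T(1) by (intro conjunct2[OF independent_span_bound] independent_units) auto
  also have "\<dots> \<le> Suc (card S + card T)"
    using card_insert_le_m1[of "Suc (card S + card T)" "S \<union> T"] card_Un_le[of S T] by simp
  finally show ?thesis using S(2) T(2) unfolding card_units by simp
qed

theorem theorem3p5:
  fixes E :: "'a set" and M N :: "'a set \<Rightarrow> bool" and I :: "'a set"
  assumes "finite_rank_matroid E M" and "loopless E M"
    and "finite_rank_matroid E N" and "loopless E N"
    and "I \<subseteq> E"
  shows "submodular_indep E (\<lambda>A. int (matroid_rank M A) + int (matroid_rank N A) - 1) I \<longleftrightarrow>
    finite I \<and> cones_dim (coord_proj I ` (bergman_fan E M + bergman_fan E N)) = card I"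
proof -
  \<comment> \<open>Over the integers the \<open>- 1\<close> amounts to a strict inequality between
    natural numbers.\<close>
  have "int a \<le> int b + int c - 1 \<longleftrightarrow> a < b + c" for a b c by linarith
  then have "submodular_indep E (\<lambda>A. int (matroid_rank M A) + int (matroid_rank N A) - 1) I \<longleftrightarrow>
      I = {} \<or> (\<forall>A\<subseteq>I. A \<noteq> {} \<longrightarrow> finite A \<and> card A < matroid_rank M A + matroid_rank N A)"
    using assms(5) by (simp add: submodular_indep_def)
  \<comment> \<open>For nonempty \<open>I\<close>, the instance \<open>A = I\<close> gives
    finiteness of \<open>I\<close>, which passes back to every subset.\<close>
  also have "\<dots> \<longleftrightarrow> finite I \<and> (\<forall>A\<subseteq>I. A \<noteq> {} \<longrightarrow> card A < matroid_rank M A + matroid_rank N A)"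
    using finite_subset[of _ I] by (cases "I = {}") auto
  finally have "submodular_indep E (\<lambda>A. int (matroid_rank M A) + int (matroid_rank N A) - 1) I \<longleftrightarrow>
      finite I \<and> (\<forall>A\<subseteq>I. A \<noteq> {} \<longrightarrow> card A < matroid_rank M A + matroid_rank N A)" .
  moreover have "(\<forall>A\<subseteq>I. A \<noteq> {} \<longrightarrow> card A < matroid_rank M A + matroid_rank N A) \<longleftrightarrow>
      cones_dim (coord_proj I ` (bergman_fan E M + bergman_fan E N)) = card I" if "finite I"
    unfolding cones_dim_bergman_sum_eq_card_iff[OF assms(1,3) that assms(5)]
    using exists_spanning_flags[OF assms(1,3) that assms(5)]
      card_less_rank_sum_if_spanning_flags[OF assms(1-4) that assms(5)]
    by blast
  ultimately show ?thesis by blast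
qed

end
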